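(* Suppose $W$ and $V$ are infinite dimensional. Let $(X_n)_{n\in\mathbb N}$ be a sequence of finite dimensional subspaces of $X$ satisfying AS and ADK. Then the $X_n$ can be perturbed along one sequence of directions so as to still satisfy AS and ADK but not DF: there exist vectors $w_n\in X$ and linear functionals $\ell_n:X_n\to\mathbb R$ ($n\in\mathbb N$), with $u\mapsto u+\ell_n(u)w_n$ injective on $X_n$, such that the sequence of spaces $\tilde X_n=\{u+\ell_n(u)\,w_n: u\in X_n\}$ satisfies AS and ADK but does not satisfy DF.
   Context: Setting. $O$ is an infinite dimensional separable real Hilbert space with scalar product $\langle\cdot,\cdot\rangle$ and norm $|\cdot|$. $X\subseteq O$ is a dense subspace, itself a Hilbert space with continuous inclusion $X\to O$. $a$ is a continuous symmetric bilinear form on $X$ with $a(u,u)\ge 0$ for all $u\in X$, such that $\langle\cdot,\cdot\rangle+a$ is coercive on $X$; this form is taken as the scalar product of $X$, so $\|u\|^2=|u|^2+a(u,u)$ is the norm of $X$. Define $W=\{u\in X: a(u,u')=0\ \forall u'\in X\}$ and $V=\{u\in X:\langle u,w\rangle=0\ \forall w\in W\}$, so $X=V\oplus W$. It is assumed that the injection $V\to O$ is compact ($V$ carrying the norm of $X$). Conditions. For a sequence $(Y_n)_{n\in\mathbb N}$ of finite dimensional subspaces of $X$, put $W_n=Y_n\cap W=\{u\in Y_n:a(u,u')=0\ \forall u'\in Y_n\}$ and $V_n=\{u\in Y_n:\langle u,w\rangle=0\ \forall w\in W_n\}$. The sequence $(Y_n)$ satisfies: AS if for all $u\in X$, $\lim_{n\to\infty}\inf_{u'\in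 Y_n}\|u-u'\|=0$; ADK if for all $w\in W$, $\lim_{n\to\infty}\inf_{w'\in W_n}|w-w'|=0$; DF if there is $C>0$ such that $|v|^2\le C\,a(v,v)$ for all $n$ and all $v\in V_n$. *)

theory Defs
  imports "HOL-Analysis.Analysis"
begin

definition finite_dim :: "'v::real_vector set \<Rightarrow> bool" where
  "finite_dim S \<longleftrightarrow> (\<exists>B. finite B \<and> S \<subseteq> span B)"

definition linear_functional_on :: "'v::real_vector set \<Rightarrow> ('v \<Rightarrow> real) \<Rightarrow> bool" where
  "linear_functional_on S f \<longleftrightarrow>
     (\<forall>x\<in>S. \<forall>y\<in>S. f (x + y) = f x + f y) \<and> (\<forall>c. \<forall>x\<in>S. f (c *\<^sub>R x) = c * f x)"

text \<open>
  The Hilbert space \<open>X\<close> is the type \<open>'x\<close>, the Hilbert space \<open>O\<close> is the type \<open>'o\<close>, and the inclusion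
  of \<open>X\<close> in \<open>O\<close> is the injective map \<open>j\<close>. The inner product of \<open>'x\<close> is \<open>\<langle>\<cdot>,\<cdot>\<rangle> + a\<close>
  (\<open>inner_eq\<close>); coercivity of that form on \<open>X\<close> is thereby built in. Hence \<open>norm u\<close> for
  \<open>u :: 'x\<close> is the norm of \<open>X\<close>, while \<open>norm (j u)\<close> is the norm of \<open>u\<close> in \<open>O\<close>.
\<close>

definition W_space :: "('x \<Rightarrow> 'x \<Rightarrow> real) \<Rightarrow> 'x set" where
  "W_space a = {u. \<forall>u'. a u u' = 0}"

definition V_space :: "('x \<Rightarrow> 'o::real_inner) \<Rightarrow> ('x \<Rightarrow> 'x \<Rightarrow> real) \<Rightarrow> 'x set" where
  "V_space j a = {u. \<forall>w\<in>W_space a. j u \<bullet> j w = 0}"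

locale hilbert_pair =
  fixes j :: "'x::{real_inner, complete_space} \<Rightarrow> 'o::{real_inner, complete_space}"
    and a :: "'x \<Rightarrow> 'x \<Rightarrow> real"
  assumes O_infinite_dim: "\<not> finite_dim (UNIV :: 'o set)"
    and O_separable: "separable_space (euclidean :: 'o topology)"
    and inclusion: "bounded_linear j" "inj j"
    and dense: "closure (range j) = UNIV"
    and a_continuous: "bounded_bilinear a"
    and a_sym: "a u v = a v u"
    and a_nonneg: "a u u \<ge> 0"
    and inner_eq: "u \<bullet> v = j u \<bullet> j v + a u v"
    and V_compact: "\<And>S. S \<subseteq> V_space j a \<Longrightarrow> bounded S \<Longrightarrow> compact (closure (j ` S))"

definition W_disc :: "('x \<Rightarrow> 'x \<Rightarrow> real) \<Rightarrow> 'x set \<Rightarrow> 'x set" where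
  "W_disc a Y = Y \<inter> W_space a"

definition V_disc :: "('x \<Rightarrow> 'o::real_inner) \<Rightarrow> ('x \<Rightarrow> 'x \<Rightarrow> real) \<Rightarrow> 'x set \<Rightarrow> 'x set" where
  "V_disc j a Y = {u \<in> Y. \<forall>w\<in>W_disc a Y. j u \<bullet> j w = 0}"

lemma (in hilbert_pair) W_disc_eq: "W_disc a Y = {u \<in> Y. \<forall>u'\<in>Y. a u u' = 0}"
proof -
  interpret a: bounded_bilinear a by (rule a_continuous)
  have "a u z = 0" if u: "a u u = 0" for u z
  proof (rule ccontr)
    assume nz: "a u z \<noteq> 0"
    define t where "t = - (a z z + 1) / (2 * a u z)"
    have "0 \<le> a (z + t *\<^sub>R u) (z + t *\<^sub>R u)" by (rule a_nonneg)
    also have "\<dots> = a z z + 2 * t * a u z"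
      using u a_sym[of z u]
      by (simp add: a.add_left a.add_right a.scaleR_left a.scaleR_right)
    also have "\<dots> = - 1" using nz by (simp add: t_def field_simps)
    finally show False by simp
  qed
  then show ?thesis by (auto simp: W_disc_def W_space_def)
qed

definition AS :: "(nat \<Rightarrow> 'x::real_normed_vector set) \<Rightarrow> bool" where
  "AS Y \<longleftrightarrow> (\<forall>u. (\<lambda>n. INF u'\<in>Y n. norm (u - u')) \<longlonglongrightarrow> 0)"

definition ADK ::
  "('x \<Rightarrow> 'o::real_normed_vector) \<Rightarrow> ('x \<Rightarrow> 'x \<Rightarrow> real) \<Rightarrow> (nat \<Rightarrow> 'x set) \<Rightarrow> bool" where
  "ADK j a Y \<longleftrightarrow>
     (\<forall>w\<in>W_space a. (\<lambda>n. INF w'\<in>W_disc a (Y n). norm (j w - j w')) \<longlonglongrightarrow> 0)"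

definition DF ::
  "('x \<Rightarrow> 'o::real_inner) \<Rightarrow> ('x \<Rightarrow> 'x \<Rightarrow> real) \<Rightarrow> (nat \<Rightarrow> 'x set) \<Rightarrow> bool" where
  "DF j a Y \<longleftrightarrow> (\<exists>C>0. \<forall>n. \<forall>v\<in>V_disc j a (Y n). (norm (j v))\<^sup>2 \<le> C * a v v)"

end

theory Submission
  imports Defs
begin

text \<open>
  Let \<open>e\<close> be an orthonormal sequence of \<open>V\<close> in the inner product of \<open>X\<close>; by Bessel it tends
  weakly to \<open>0\<close>. By AS the spaces \<open>V\<^sub>n\<close> approximate \<open>V\<close>, so a diagonal choice gives unit vectors
  \<open>v\<^sub>n \<in> V\<^sub>n\<close> that still tend weakly to \<open>0\<close>. Choose a unit vector \<open>w\<^sub>n \<in> W\<close> orthogonal to \<open>X\<^sub>n\<close> and put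
  \<open>\<ell>\<^sub>n(u) = n (u \<bullet> v\<^sub>n)\<close>. The kernel of \<open>\<ell>\<^sub>n\<close> is contained in the perturbed space and its distance to
  a fixed \<open>u\<close> exceeds that of \<open>X\<^sub>n\<close> by a quantity controlled by \<open>u \<bullet> v\<^sub>n\<close>, whence AS although the
  norm of \<open>\<ell>\<^sub>n\<close> blows up. As \<open>\<ell>\<^sub>n\<close> vanishes on \<open>W\<^sub>n\<close>, the discrete kernel, and with it ADK, is
  unchanged. Finally \<open>v\<^sub>n + n w\<^sub>n\<close> lies in the new discrete \<open>V\<close>, has \<open>a\<close>-energy at most \<open>1\<close>, and is
  unbounded in \<open>O\<close>.
\<close>

section \<open>Orthonormal sequences in inner product spaces\<close>

text \<open>One linear equation lowers the dimension by at most one: a single \<open>s\<close> in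
  \<open>S\<close> off the hyperplane, added to a finite spanning set of the slice, spans all of
  \<open>S\<close>.\<close>

lemma not_finite_dim_orthogonal_slice:
  fixes S :: "'v::real_inner set"
  assumes S: "subspace S" and inf: "\<not> finite_dim S"
  shows "\<not> finite_dim {x \<in> S. x \<bullet> f = 0}"
proof
  assume "finite_dim {x \<in> S. x \<bullet> f = 0}"
  then obtain B where B: "finite B" "{x \<in> S. x \<bullet> f = 0} \<subseteq> span B"
    by (auto simp: finite_dim_def)
  show False
  proof (cases "\<exists>s\<in>S. s \<bullet> f \<noteq> 0")
    case False
    then have "S \<subseteq> span B" using B(2) by auto
    with B(1) inf show False by (auto simp: finite_dim_def)
  next
    case True
    then obtain s where s: "s \<in> S" "s \<bullet> f \<noteq> 0" by auto
    have "x \<in> span (insert s B)" if "x \<in> S" for x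
    proof -
      define k where "k = (x \<bullet> f) / (s \<bullet> f)"
      have "x - k *\<^sub>R s \<in> S"
        using S s(1) that by (simp add: subspace_diff subspace_scale)
      moreover have "(x - k *\<^sub>R s) \<bullet> f = 0"
        using s(2) by (simp add: k_def inner_diff_left)
      ultimately have "x - k *\<^sub>R s \<in> span B" using B(2) by auto
      then show ?thesis by (auto simp: span_insert)
    qed
    then have "S \<subseteq> span (insert s B)" by auto
    with B(1) inf show False by (metis finite_dim_def finite_insert)
  qed
qed

text \<open>Each vector of \<open>F\<close> is used up by replacing \<open>S\<close> with its slice
  orthogonal to that vector, which is again infinite dimensional; hence the induction leaves
  \<open>S\<close> arbitrary.\<close>

lemma exists_unit_orthogonal:
  fixes S :: "'v::real_inner set"
  assumes "finite F" "subspace S" "\<not> finite_dim S"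
  shows "\<exists>x\<in>S. norm x = 1 \<and> (\<forall>f\<in>F. x \<bullet> f = 0)"
  using assms
proof (induction F arbitrary: S rule: finite_induct)
  case empty
  have "\<not> S \<subseteq> {0}"
    using empty.prems(2) by (metis finite.emptyI finite_dim_def span_empty)
  then obtain x where x: "x \<in> S" "x \<noteq> 0" by auto
  then have "sgn x \<in> S" using empty.prems(1) by (simp add: sgn_div_norm subspace_scale)
  with x show ?case by (intro bexI[of _ "sgn x"]) (simp_all add: norm_sgn)
next
  case (insert f F)
  let ?T = "{x \<in> S. x \<bullet> f = 0}"
  have "subspace ?T"
    using insert.prems(1) by (auto simp: subspace_def inner_add_left)
  from insert.IH[OF this not_finite_dim_orthogonal_slice[OF insert.prems]] show ?case
    by auto
qed

lemma exists_orthonormal_sequence: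
  fixes S :: "'v::real_inner set"
  assumes S: "subspace S" "\<not> finite_dim S"
  obtains e :: "nat \<Rightarrow> 'v" where "\<And>k. e k \<in> S" "\<And>k. norm (e k) = 1"
    "\<And>i k. i < k \<Longrightarrow> e k \<bullet> e i = 0"
proof -
  have "\<exists>e::nat \<Rightarrow> 'v. \<forall>k. e k \<in> S \<and> norm (e k) = 1 \<and> (\<forall>i<k. e k \<bullet> e i = 0)"
  proof (rule dependent_wellorder_choice)
    fix f :: "nat \<Rightarrow> 'v" and k
    show "\<exists>r. r \<in> S \<and> norm r = 1 \<and> (\<forall>i<k. r \<bullet> f i = 0)"
      using exists_unit_orthogonal[of "f ` {..<k}", OF _ S] by auto
  qed auto
  then show ?thesis using that by metis
qed

text \<open>Bessel's inequality, from expanding the squared norm of \<open>u\<close> minus its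
  partial Fourier sum.\<close>

lemma orthonormal_bessel:
  fixes e :: "nat \<Rightarrow> 'v::real_inner"
  assumes e: "\<And>k. norm (e k) = 1" "\<And>i k. i < k \<Longrightarrow> e k \<bullet> e i = 0"
  shows "(\<Sum>k<N. (u \<bullet> e k)\<^sup>2) \<le> (norm u)\<^sup>2"
proof -
  define s where "s N = (\<Sum>k<N. (u \<bullet> e k) *\<^sub>R e k)" for N
  have "e k \<bullet> e N = 0" if "k < N" for k N using e(2)[OF that] by (simp add: inner_commute)
  then have orth: "s N \<bullet> e N = 0" for N by (simp add: s_def inner_sum_left)
  have us: "u \<bullet> s N = (\<Sum>k<N. (u \<bullet> e k)\<^sup>2)" for N
    by (simp add: s_def inner_sum_right power2_eq_square)
  have ss: "s N \<bullet> s N = (\<Sum>k<N. (u \<bullet> e k)\<^sup>2)" for N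
  proof (induction N)
    case (Suc N)
    have "s (Suc N) = s N + (u \<bullet> e N) *\<^sub>R e N" by (simp add: s_def)
    with Suc orth[of N] show ?case
      using e(1)[of N]
      by (simp add: inner_add inner_commute[of "e N" "s N"] power2_eq_square norm_eq_1)
  qed (simp add: s_def)
  have "0 \<le> (u - s N) \<bullet> (u - s N)" by simp
  also have "\<dots> = u \<bullet> u - 2 * (u \<bullet> s N) + s N \<bullet> s N"
    by (simp add: inner_diff inner_commute)
  finally show ?thesis by (simp add: us ss power2_norm_eq_inner)
qed

lemma orthonormal_weakly_null:
  fixes e :: "nat \<Rightarrow> 'v::real_inner"
  assumes e: "\<And>k. norm (e k) = 1" "\<And>i k. i < k \<Longrightarrow> e k \<bullet> e i = 0"
  shows "(\<lambda>k. u \<bullet> e k) \<longlonglongrightarrow> 0"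
proof -
  have "summable (\<lambda>k. (u \<bullet> e k)\<^sup>2)"
    by (rule summableI_nonneg_bounded[of _ "(norm u)\<^sup>2"])
      (auto intro: orthonormal_bessel[OF e])
  then have "(\<lambda>k. (u \<bullet> e k)\<^sup>2) \<longlonglongrightarrow> 0" by (rule summable_LIMSEQ_zero)
  then show ?thesis by simp
qed

text \<open>Gram-Schmidt replaces \<open>B\<close> by an orthogonal set \<open>C\<close> with the
  same span, for which the projection has an explicit formula; a zero vector in \<open>C\<close> is
  harmless, since division by zero yields zero.\<close>

lemma exists_orthogonal_decomposition:
  fixes x :: "'v::real_inner"
  assumes "finite B"
  shows "\<exists>p\<in>span B. \<forall>z\<in>span B. (x - p) \<bullet> z = 0"
proof -
  obtain C where C: "finite C" "span C = span B" "pairwise orthogonal C"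
    using basis_orthogonal[OF assms] by blast
  define p where "p = (\<Sum>c\<in>C. (c \<bullet> x / (c \<bullet> c)) *\<^sub>R c)"
  have "orthogonal (x - p) c" if c: "c \<in> C" for c
  proof -
    have "p \<bullet> c = (\<Sum>b\<in>C. if b = c then c \<bullet> x else 0)"
      unfolding p_def inner_sum_left
      using C(3) c by (intro sum.cong) (auto simp: pairwise_def orthogonal_def)
    also have "\<dots> = c \<bullet> x" using C(1) c by simp
    finally show ?thesis by (simp add: orthogonal_def inner_diff_left inner_commute[of c])
  qed
  then have "\<forall>z\<in>span B. (x - p) \<bullet> z = 0"
    using orthogonal_to_span C(2) by (metis orthogonal_def)
  moreover have "p \<in> span B"
    unfolding p_def C(2)[symmetric] by (intro span_sum span_scale span_base)
  ultimately show ?thesis by blast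
qed

lemma finite_dim_subspace_spanning_set:
  assumes "finite_dim S" "subspace S"
  obtains B where "finite B" "span B = S"
proof -
  obtain F where F: "finite F" "S \<subseteq> span F" using assms(1) by (auto simp: finite_dim_def)
  obtain B where B: "B \<subseteq> S" "independent B" "S \<subseteq> span B" using basis_exists[of S] by metis
  have "finite B" using independent_span_bound[OF F(1) B(2)] B(1) F(2) by auto
  moreover have "span B = S"
    using B assms(2) by (meson span_minimal subset_antisym)
  ultimately show ?thesis using that by blast
qed

section \<open>Approximation and diagonal choice\<close>

lemma AS_iff_infdist:
  assumes "\<And>n. Y n \<noteq> {}"
  shows "AS Y \<longleftrightarrow> (\<forall>u. (\<lambda>n. infdist u (Y n)) \<longlonglongrightarrow> 0)"
  using assms by (simp add: AS_def infdist_notempty dist_norm)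

text \<open>Normalising moves \<open>v\<close> by the difference between the norms of
  \<open>v\<close> and \<open>e\<close>, which is at most their distance.\<close>

lemma norm_diff_sgn_le:
  fixes e v :: "'v::real_normed_vector"
  assumes "norm e = 1" "v \<noteq> 0"
  shows "norm (e - sgn v) \<le> 2 * norm (e - v)"
proof -
  have "v - sgn v = (norm v - 1) *\<^sub>R sgn v"
    using assms(2) by (simp add: sgn_div_norm left_diff_distrib scaleR_diff_left)
  then have "norm (v - sgn v) = \<bar>norm v - norm e\<bar>"
    using assms by (simp add: norm_sgn)
  also have "\<dots> \<le> norm (e - v)" by (metis norm_minus_commute norm_triangle_ineq3)
  finally show ?thesis using norm_triangle_ineq[of "e - v" "v - sgn v"] by simp
qed

text \<open>The largest admissible \<open>k\<close> is taken at each \<open>n\<close>. Every fixed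
  \<open>k\<close> eventually competes, so the maximum tends to infinity; the cap
  \<open>k \<le> n\<close> keeps the set finite.\<close>

lemma diagonal_index:
  fixes P :: "nat \<Rightarrow> nat \<Rightarrow> bool"
  assumes ev: "\<And>k. \<forall>\<^sub>F n in sequentially. P k n"
  obtains \<kappa> where "filterlim \<kappa> at_top sequentially" "\<forall>\<^sub>F n in sequentially. P (\<kappa> n) n"
proof -
  define \<kappa> where "\<kappa> n = Max {k. k \<le> n \<and> P k n}" for n
  have fin: "finite {k. k \<le> n \<and> P k n}" for n by auto
  have "\<forall>\<^sub>F n in sequentially. k \<le> \<kappa> n" for k
    using ev[of k] eventually_ge_at_top[of k]
    by eventually_elim (use fin in \<open>auto simp: \<kappa>_def intro!: Max_ge\<close>)
  then have "filterlim \<kappa> at_top sequentially" by (simp add: filterlim_at_top)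
  moreover have "\<forall>\<^sub>F n in sequentially. P (\<kappa> n) n"
    using ev[of 0]
  proof eventually_elim
    case (elim n)
    then have "{k. k \<le> n \<and> P k n} \<noteq> {}" by auto
    from Max_in[OF fin this] show ?case by (simp add: \<kappa>_def)
  qed
  ultimately show ?thesis using that by blast
qed

text \<open>Removing from an approximant \<open>x\<close> its component along \<open>v\<close> costs
  the size of \<open>x \<bullet> v\<close>, which is close to \<open>u \<bullet> v\<close> when
  \<open>x\<close> is close to \<open>u\<close>. Rescaling the functional leaves its kernel, and so
  this bound, unchanged.\<close>

lemma infdist_inner_kernel_le:
  fixes S :: "'v::real_inner set"
  assumes S: "subspace S" and v: "v \<in> S" "norm v = 1"
  shows "infdist u {x \<in> S. x \<bullet> v = 0} \<le> 2 * infdist u S + \<bar>u \<bullet> v\<bar>"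
proof -
  let ?K = "{x \<in> S. x \<bullet> v = 0}"
  \<comment> \<open>Solved for the distance, the estimate is a lower bound valid for every
    \<open>x\<close>, so it passes to the infimum.\<close>
  have "(infdist u ?K - \<bar>u \<bullet> v\<bar>) / 2 \<le> dist u x" if x: "x \<in> S" for x
  proof -
    define y where "y = x - (x \<bullet> v) *\<^sub>R v"
    have "y \<in> ?K"
      using S v x by (simp add: y_def inner_diff_left subspace_diff subspace_scale norm_eq_1)
    then have "infdist u ?K \<le> norm (u - y)" by (metis infdist_le dist_norm)
    also have "\<dots> \<le> norm (u - x) + \<bar>x \<bullet> v\<bar>"
      using norm_triangle_ineq[of "u - x" "(x \<bullet> v) *\<^sub>R v"] v(2)
      by (simp add: y_def algebra_simps)
    also have "\<bar>x \<bullet> v\<bar> \<le> \<bar>u \<bullet> v\<bar> + \<bar>(u - x) \<bullet> v\<bar>" by (simp add: inner_diff_left)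
    also have "\<bar>(u - x) \<bullet> v\<bar> \<le> norm (u - x)"
      using Cauchy_Schwarz_ineq2[of "u - x" v] v(2) by simp
    finally show ?thesis by (simp add: dist_norm)
  qed
  moreover have "S \<noteq> {}" using v(1) by blast
  ultimately have "(infdist u ?K - \<bar>u \<bullet> v\<bar>) / 2 \<le> infdist u S"
    unfolding infdist_notempty[OF \<open>S \<noteq> {}\<close>] by (intro cINF_greatest)
  then show ?thesis by simp
qed

section \<open>Discrete kernels in a Hilbert pair\<close>

context hilbert_pair
begin

lemma a_W_left: "w \<in> W_space a \<Longrightarrow> a w u = 0"
  by (simp add: W_space_def)

lemma a_W_right: "w \<in> W_space a \<Longrightarrow> a u w = 0"
  using a_sym by (simp add: W_space_def)

text \<open>Orthogonality to the kernel is thus the same in \<open>X\<close> and in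
  \<open>O\<close>, so all later arguments use the inner product of \<open>X\<close> alone.\<close>

lemma inner_j_W: "w \<in> W_space a \<Longrightarrow> j u \<bullet> j w = u \<bullet> w"
  by (simp add: inner_eq a_W_right)

lemma a_le_norm: "a u u \<le> (norm u)\<^sup>2"
  by (simp add: power2_norm_eq_inner inner_eq)

lemma subspace_W: "subspace (W_space a)"
proof -
  interpret a: bounded_bilinear a by (rule a_continuous)
  show ?thesis
    by (auto simp: subspace_def W_space_def a.add_left a.scaleR_left a.zero_left)
qed

lemma V_space_eq: "V_space j a = {u. \<forall>w\<in>W_space a. u \<bullet> w = 0}"
  by (simp add: V_space_def inner_j_W)

lemma V_disc_eq: "V_disc j a Y = {u \<in> Y. \<forall>w\<in>W_disc a Y. u \<bullet> w = 0}"
  by (auto simp: V_disc_def W_disc_def inner_j_W)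

lemma subspace_V: "subspace (V_space j a)"
  by (auto simp: subspace_def V_space_eq inner_add_left)

lemma subspace_W_disc: "subspace Y \<Longrightarrow> subspace (W_disc a Y)"
  by (simp add: W_disc_def subspace_inter subspace_W)

lemma subspace_V_disc: "subspace Y \<Longrightarrow> subspace (V_disc j a Y)"
  by (auto simp: subspace_def V_disc_eq inner_add_left)

text \<open>The witness is \<open>x\<close> minus its projection \<open>p\<close> on the discrete
  kernel. Both \<open>e\<close> and \<open>x - p\<close> are orthogonal to \<open>p\<close>, so by
  Pythagoras dropping \<open>p\<close> cannot increase the distance to \<open>e\<close>.\<close>

lemma V_disc_approx:
  assumes Y: "subspace Y" "finite_dim Y" and e: "e \<in> V_space j a" and x: "x \<in> Y"
  shows "\<exists>v\<in>V_disc j a Y. norm (e - v) \<le> norm (e - x)"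
proof -
  have "finite_dim (W_disc a Y)" using Y(2) by (auto simp: finite_dim_def W_disc_def)
  then obtain B where B: "finite B" "span B = W_disc a Y"
    using finite_dim_subspace_spanning_set subspace_W_disc[OF Y(1)] by blast
  obtain p where p: "p \<in> W_disc a Y" "\<forall>z\<in>W_disc a Y. (x - p) \<bullet> z = 0"
    using exists_orthogonal_decomposition[OF B(1), of x] B(2) by auto
  have v: "x - p \<in> V_disc j a Y"
    using p x Y(1) by (auto simp: V_disc_eq W_disc_def subspace_diff)
  have "e \<bullet> p = 0" using e p(1) by (auto simp: V_space_eq W_disc_def)
  then have orth: "orthogonal (e - (x - p)) (- p)"
    using p by (simp add: orthogonal_def inner_diff_left)
  have "(norm (e - x))\<^sup>2 = (norm (e - (x - p)))\<^sup>2 + (norm p)\<^sup>2"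
    using norm_add_Pythagorean[OF orth] by simp
  then have "(norm (e - (x - p)))\<^sup>2 \<le> (norm (e - x))\<^sup>2" by simp
  then have "norm (e - (x - p)) \<le> norm (e - x)" by (rule power2_le_imp_le) simp
  with v show ?thesis by blast
qed

lemma eventually_unit_V_disc_near:
  assumes X: "\<And>n. subspace (X n)" "\<And>n. finite_dim (X n)" and AS: "AS X"
    and e: "e \<in> V_space j a" "norm e = 1" and d: "\<delta> > 0"
  shows "\<forall>\<^sub>F n in sequentially. \<exists>v\<in>V_disc j a (X n). norm v = 1 \<and> norm (e - v) < \<delta>"
proof -
  \<comment> \<open>The half pays for the factor 2 lost in normalising; the bound 1 forces the
    approximant of the unit vector \<open>e\<close> to be nonzero.\<close>
  define \<epsilon> where "\<epsilon> = min (\<delta> / 2) 1"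
  have eps: "\<epsilon> > 0" "\<epsilon> \<le> 1" "2 * \<epsilon> \<le> \<delta>" using d by (auto simp: \<epsilon>_def)
  have ne: "X n \<noteq> {}" for n using subspace_0[OF X(1)] by blast
  have "(\<lambda>n. infdist e (X n)) \<longlonglongrightarrow> 0" using AS ne by (simp add: AS_iff_infdist)
  then have "\<forall>\<^sub>F n in sequentially. infdist e (X n) < \<epsilon>"
    using eps(1) by (rule order_tendstoD)
  then show ?thesis
  proof eventually_elim
    case (elim n)
    then have "\<exists>x\<in>X n. dist e x < \<epsilon>"
      using ne[of n] by (simp add: infdist_notempty cINF_less_iff)
    then obtain x where x: "x \<in> X n" "norm (e - x) < \<epsilon>" by (auto simp: dist_norm)
    from V_disc_approx[OF X e(1) x(1)] x(2)
    obtain v where v: "v \<in> V_disc j a (X n)" "norm (e - v) < \<epsilon>" by fastforce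
    have "v \<noteq> 0" using v(2) e(2) eps(2) by auto
    moreover have "sgn v \<in> V_disc j a (X n)"
      using v(1) by (simp add: sgn_div_norm subspace_scale subspace_V_disc X(1))
    moreover have "norm (e - sgn v) < \<delta>"
      using norm_diff_sgn_le[OF e(2) \<open>v \<noteq> 0\<close>] v(2) eps(3) by simp
    ultimately show ?case by (intro bexI[of _ "sgn v"]) (simp_all add: norm_sgn)
  qed
qed

lemma exists_weakly_null_V_disc:
  assumes X: "\<And>n. subspace (X n)" "\<And>n. finite_dim (X n)" and AS: "AS X"
    and V: "\<not> finite_dim (V_space j a)"
  obtains v where "\<forall>\<^sub>F n in sequentially. v n \<in> V_disc j a (X n) \<and> norm (v n) = 1"
    "\<And>u. (\<lambda>n. u \<bullet> v n) \<longlonglongrightarrow> 0"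
proof -
  obtain e where e: "\<And>k::nat. e k \<in> V_space j a" "\<And>k. norm (e k) = 1"
    "\<And>i k. i < k \<Longrightarrow> e k \<bullet> e i = 0"
    using exists_orthonormal_sequence[OF subspace_V V] by blast
  define P where "P k n v \<longleftrightarrow> v \<in> V_disc j a (X n) \<and> norm v = 1 \<and> norm (e k - v) < 1 / real (Suc k)"
    for k n v
  have "\<forall>\<^sub>F n in sequentially. \<exists>v. P k n v" for k
    using eventually_unit_V_disc_near[OF X AS e(1,2)[of k], of "1 / real (Suc k)"]
    by (simp add: P_def Bex_def)
  from diagonal_index[of "\<lambda>k n. \<exists>v. P k n v", OF this]
  obtain \<kappa> where \<kappa>: "filterlim \<kappa> at_top sequentially"
    "\<forall>\<^sub>F n in sequentially. \<exists>v. P (\<kappa> n) n v" by blast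
  \<comment> \<open>The choice is arbitrary where no such vector exists, which happens for finitely
    many \<open>n\<close> only.\<close>
  define v where "v n = (SOME v. P (\<kappa> n) n v)" for n
  have Pv: "\<forall>\<^sub>F n in sequentially. P (\<kappa> n) n (v n)"
    using \<kappa>(2) by eventually_elim (auto simp: v_def intro: someI_ex)
  have "(\<lambda>n. u \<bullet> v n) \<longlonglongrightarrow> 0" for u
  proof (rule Lim_null_comparison)
    show "\<forall>\<^sub>F n in sequentially.
        norm (u \<bullet> v n) \<le> \<bar>u \<bullet> e (\<kappa> n)\<bar> + norm u * (1 / real (Suc (\<kappa> n)))"
      using Pv
    proof eventually_elim
      case (elim n)
      have "\<bar>u \<bullet> v n\<bar> \<le> \<bar>u \<bullet> e (\<kappa> n)\<bar> + \<bar>u \<bullet> (e (\<kappa> n) - v n)\<bar>" by (simp add: inner_diff_right)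
      also have "\<bar>u \<bullet> (e (\<kappa> n) - v n)\<bar> \<le> norm u * norm (e (\<kappa> n) - v n)"
        by (rule Cauchy_Schwarz_ineq2)
      also have "\<dots> \<le> norm u * (1 / real (Suc (\<kappa> n)))"
        using elim by (intro mult_left_mono) (auto simp: P_def)
      finally show ?case by simp
    qed
    have "(\<lambda>k. \<bar>u \<bullet> e k\<bar> + norm u * (1 / real (Suc k))) \<longlonglongrightarrow> \<bar>0\<bar> + norm u * 0"
      by (intro tendsto_intros orthonormal_weakly_null[OF e(2,3)] lim_1_over_n LIMSEQ_Suc)
    from filterlim_compose[OF this \<kappa>(1)]
    show "(\<lambda>n. \<bar>u \<bullet> e (\<kappa> n)\<bar> + norm u * (1 / real (Suc (\<kappa> n)))) \<longlonglongrightarrow> 0" by simp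
  qed
  moreover have "\<forall>\<^sub>F n in sequentially. v n \<in> V_disc j a (X n) \<and> norm (v n) = 1"
    using Pv by eventually_elim (simp add: P_def)
  ultimately show ?thesis using that by blast
qed

lemma exists_unit_W_orthogonal:
  assumes W: "\<not> finite_dim (W_space a)" and Y: "finite_dim Y"
  shows "\<exists>w\<in>W_space a. norm w = 1 \<and> (\<forall>u\<in>Y. u \<bullet> w = 0)"
proof -
  obtain B where B: "finite B" "Y \<subseteq> span B" using Y by (auto simp: finite_dim_def)
  from exists_unit_orthogonal[OF B(1) subspace_W W]
  obtain w where w: "w \<in> W_space a" "norm w = 1" "\<forall>b\<in>B. orthogonal w b"
    by (auto simp: orthogonal_def)
  have "u \<bullet> w = 0" if "u \<in> Y" for u
    using orthogonal_to_span[of u B w] w(3) B(2) that by (auto simp: orthogonal_def inner_commute)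
  with w show ?thesis by blast
qed

section \<open>Rank-one perturbations along the kernel of the form\<close>

lemma W_disc_perturb:
  assumes w: "w \<in> W_space a" and l: "\<And>u. u \<in> W_disc a Y \<Longrightarrow> l u = 0"
  shows "W_disc a ((\<lambda>u. u + l u *\<^sub>R w) ` Y) = W_disc a Y"
proof -
  have "u + l u *\<^sub>R w \<in> W_space a \<longleftrightarrow> u \<in> W_space a" for u
  proof
    assume "u + l u *\<^sub>R w \<in> W_space a"
    from subspace_diff[OF subspace_W this subspace_scale[OF subspace_W w, of "l u"]]
    show "u \<in> W_space a" by simp
  next
    assume "u \<in> W_space a"
    then show "u + l u *\<^sub>R w \<in> W_space a"
      by (intro subspace_add subspace_scale subspace_W w)
  qed
  \<comment> \<open>Shifting by multiples of \<open>w\<close> neither creates nor destroys kernel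
    vectors, and the shift is zero on those already there.\<close>
  then have "W_disc a ((\<lambda>u. u + l u *\<^sub>R w) ` Y) = (\<lambda>u. u + l u *\<^sub>R w) ` W_disc a Y"
    unfolding W_disc_def by blast
  also have "\<dots> = id ` W_disc a Y"
    by (rule image_cong) (simp_all add: l)
  finally show ?thesis by simp
qed

text \<open>The discrete kernel is unchanged and lies in \<open>Y\<close>, so it is orthogonal both
  to \<open>v\<close> and to the added direction \<open>w\<close>.\<close>

lemma V_disc_perturb:
  assumes w: "w \<in> W_space a" "\<forall>u\<in>Y. u \<bullet> w = 0"
    and l: "\<And>u. u \<in> W_disc a Y \<Longrightarrow> l u = 0" and v: "v \<in> V_disc j a Y"
  shows "v + l v *\<^sub>R w \<in> V_disc j a ((\<lambda>u. u + l u *\<^sub>R w) ` Y)"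
proof -
  have "(v + l v *\<^sub>R w) \<bullet> u = 0" if "u \<in> W_disc a Y" for u
  proof -
    have "v \<bullet> u = 0" using v that by (simp add: V_disc_eq)
    moreover have "w \<bullet> u = 0" using w(2) that by (simp add: W_disc_def inner_commute)
    ultimately show ?thesis by (simp add: inner_add_left)
  qed
  moreover have "v \<in> Y" using v by (simp add: V_disc_eq)
  moreover have "W_disc a ((\<lambda>u. u + l u *\<^sub>R w) ` Y) = W_disc a Y"
    using w(1) l by (rule W_disc_perturb)
  ultimately show ?thesis
    unfolding V_disc_eq by blast
qed

lemma a_perturb:
  assumes "w \<in> W_space a"
  shows "a (v + c *\<^sub>R w) (v + c *\<^sub>R w) = a v v"
proof -
  interpret a: bounded_bilinear a by (rule a_continuous)
  show ?thesis
    using assms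
    by (simp add: a.add_left a.add_right a.scaleR_left a.scaleR_right a_W_left a_W_right)
qed

text \<open>By orthogonality the added direction contributes exactly \<open>c\<^sup>2\<close> to the
  squared norm in \<open>X\<close>, and none of it is energy for \<open>a\<close>.\<close>

lemma norm_j_perturb_ge:
  assumes w: "w \<in> W_space a" "norm w = 1" "v \<bullet> w = 0"
  shows "c\<^sup>2 \<le> (norm (j (v + c *\<^sub>R w)))\<^sup>2"
proof -
  have "(norm (j (v + c *\<^sub>R w)))\<^sup>2 = (v + c *\<^sub>R w) \<bullet> (v + c *\<^sub>R w) - a v v"
    by (simp add: inner_eq a_perturb w(1) power2_norm_eq_inner)
  also have "\<dots> = (v \<bullet> v - a v v) + c\<^sup>2"
    using w(2,3) by (simp add: inner_add inner_commute[of w v] norm_eq_1 power2_eq_square)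
  finally show ?thesis using a_le_norm[of v] by (simp add: power2_norm_eq_inner)
qed

end

section \<open>Construction and verification of the perturbed spaces\<close>

theorem proposition20:
  fixes j :: "'x::{real_inner, complete_space} \<Rightarrow> 'o::{real_inner, complete_space}"
    and a :: "'x \<Rightarrow> 'x \<Rightarrow> real"
    and X :: "nat \<Rightarrow> 'x set"
  assumes "hilbert_pair j a"
    and "\<not> finite_dim (W_space a)"
    and "\<not> finite_dim (V_space j a)"
    and "\<And>n. subspace (X n)"
    and "\<And>n. finite_dim (X n)"
    and "AS X"
    and "ADK j a X"
  shows "\<exists>(w :: nat \<Rightarrow> 'x) (l :: nat \<Rightarrow> 'x \<Rightarrow> real).
           (\<forall>n. linear_functional_on (X n) (l n)) \<and>
           (\<forall>n. inj_on (\<lambda>u. u + l n u *\<^sub>R w n) (X n)) \<and>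
           AS (\<lambda>n. (\<lambda>u. u + l n u *\<^sub>R w n) ` X n) \<and>
           ADK j a (\<lambda>n. (\<lambda>u. u + l n u *\<^sub>R w n) ` X n) \<and>
           \<not> DF j a (\<lambda>n. (\<lambda>u. u + l n u *\<^sub>R w n) ` X n)"
proof -
  interpret hilbert_pair j a by (rule assms(1))
  obtain v0 where v0: "\<forall>\<^sub>F n in sequentially. v0 n \<in> V_disc j a (X n) \<and> norm (v0 n) = 1"
    "\<And>u. (\<lambda>n. u \<bullet> v0 n) \<longlonglongrightarrow> 0"
    using exists_weakly_null_V_disc[OF assms(4,5,6,3)] by blast
  let ?good = "\<lambda>n. v0 n \<in> V_disc j a (X n) \<and> norm (v0 n) = 1"
  \<comment> \<open>The default 0 at the finitely many bad indices gives membership in the discrete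
    \<open>V\<close> for every \<open>n\<close>; there \<open>l n\<close> is zero and the space is
    left as it was.\<close>
  define v where "v n = (if ?good n then v0 n else 0)" for n
  have v_mem: "v n \<in> V_disc j a (X n)" for n
    using subspace_0[OF subspace_V_disc[OF assms(4)]] by (simp add: v_def)
  obtain w where w: "\<And>n. w n \<in> W_space a" "\<And>n. norm (w n) = 1" "\<And>n. \<forall>u\<in>X n. u \<bullet> w n = 0"
    using exists_unit_W_orthogonal[OF assms(2,5)] by metis
  define l where "l n u = real n * (u \<bullet> v n)" for n u
  let ?X = "\<lambda>n. (\<lambda>u. u + l n u *\<^sub>R w n) ` X n"
  have ne: "X n \<noteq> {}" for n using subspace_0[OF assms(4)] by blast
  have l_W: "l n u = 0" if "u \<in> W_disc a (X n)" for n u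
    using v_mem[of n] that by (simp add: l_def V_disc_eq inner_commute)
  have lin: "linear_functional_on (X n) (l n)" for n
    by (simp add: linear_functional_on_def l_def inner_add_left algebra_simps)
  have inj: "inj_on (\<lambda>u. u + l n u *\<^sub>R w n) (X n)" for n
  proof (rule inj_onI)
    fix x y assume xy: "x \<in> X n" "y \<in> X n" "x + l n x *\<^sub>R w n = y + l n y *\<^sub>R w n"
    \<comment> \<open>Pairing with the unit vector \<open>w n\<close>, orthogonal to
      \<open>X n\<close>, reads off the value of the functional.\<close>
    have "(x + l n x *\<^sub>R w n) \<bullet> w n = (y + l n y *\<^sub>R w n) \<bullet> w n" using xy(3) by simp
    then have "l n x = l n y"
      using xy(1,2) w(2,3)[of n] by (auto simp: inner_add_left norm_eq_1)
    with xy(3) show "x = y" by simp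
  qed
  have "(\<lambda>n. infdist u (?X n)) \<longlonglongrightarrow> 0" for u
  proof (rule Lim_null_comparison)
    show "\<forall>\<^sub>F n in sequentially. norm (infdist u (?X n)) \<le> 2 * infdist u (X n) + \<bar>u \<bullet> v0 n\<bar>"
      using v0(1)
    proof eventually_elim
      case (elim n)
      let ?K = "{x \<in> X n. x \<bullet> v0 n = 0}"
      \<comment> \<open>The perturbation fixes every point of the kernel of
        \<open>l n\<close>.\<close>
      have "?K \<subseteq> ?X n"
      proof
        fix x assume "x \<in> ?K"
        then have "x \<in> X n" "x = x + l n x *\<^sub>R w n" using elim by (simp_all add: l_def v_def)
        then show "x \<in> ?X n" by (rule rev_image_eqI)
      qed
      moreover have "?K \<noteq> {}" using subspace_0[OF assms(4)[of n]] by auto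
      ultimately have "infdist u (?X n) \<le> infdist u ?K" by (intro infdist_mono)
      also have "\<dots> \<le> 2 * infdist u (X n) + \<bar>u \<bullet> v0 n\<bar>"
        using elim by (intro infdist_inner_kernel_le assms(4)) (auto simp: V_disc_def)
      finally show ?case by (simp add: infdist_nonneg)
    qed
    have "(\<lambda>n. infdist u (X n)) \<longlonglongrightarrow> 0" using assms(6) ne by (simp add: AS_iff_infdist)
    then have "(\<lambda>n. 2 * infdist u (X n) + \<bar>u \<bullet> v0 n\<bar>) \<longlonglongrightarrow> 2 * 0 + \<bar>0\<bar>"
      by (intro tendsto_intros v0(2))
    then show "(\<lambda>n. 2 * infdist u (X n) + \<bar>u \<bullet> v0 n\<bar>) \<longlonglongrightarrow> 0" by simp
  qed
  then have AS: "AS ?X" using ne by (subst AS_iff_infdist) auto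
  have W_eq: "W_disc a (?X n) = W_disc a (X n)" for n
    using w(1) l_W by (rule W_disc_perturb)
  have ADK: "ADK j a ?X"
    using assms(7) unfolding ADK_def W_eq .
  have DF: "\<not> DF j a ?X"
  proof
    assume "DF j a ?X"
    then obtain C where C: "C > 0"
      "\<And>n z. z \<in> V_disc j a (?X n) \<Longrightarrow> (norm (j z))\<^sup>2 \<le> C * a z z"
      unfolding DF_def by blast
    obtain M :: nat where M: "C < real M" using reals_Archimedean2 by blast
    \<comment> \<open>At such an \<open>n\<close> the constant satisfies
      \<open>C < n \<le> n\<^sup>2\<close>, while DF would give
      \<open>n\<^sup>2 \<le> C\<close>.\<close>
    have "\<forall>\<^sub>F n in sequentially. ?good n \<and> M \<le> n \<and> 1 \<le> n"
      using v0(1) eventually_ge_at_top[of M] eventually_ge_at_top[of 1]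
      by eventually_elim auto
    from eventually_happens'[OF sequentially_bot this]
    obtain n where n: "?good n" "M \<le> n" "1 \<le> n" by blast
    have vn: "norm (v n) = 1" "v n \<bullet> v n = 1" using n(1) by (simp_all add: v_def norm_eq_1)
    have ln: "l n (v n) = real n" by (simp add: l_def vn(2))
    let ?z = "v n + real n *\<^sub>R w n"
    have "v n \<in> X n" using v_mem[of n] by (simp add: V_disc_def)
    then have "(real n)\<^sup>2 \<le> (norm (j ?z))\<^sup>2"
      using w(3)[of n] by (intro norm_j_perturb_ge w) auto
    also have "\<dots> \<le> C * a ?z ?z"
      using V_disc_perturb[where l = "l n", OF w(1)[of n] w(3)[of n] l_W v_mem[of n]]
      unfolding ln by (rule C(2))
    \<comment> \<open>The \<open>w n\<close> component carries no energy, so the energy of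
      \<open>?z\<close> is that of the unit vector \<open>v n\<close>.\<close>
    also have "\<dots> \<le> C * 1"
      using C(1) a_le_norm[of "v n"] vn(1) by (intro mult_left_mono) (auto simp: a_perturb w(1))
    also have "\<dots> < real n" using M n(2) by simp
    also have "\<dots> \<le> (real n)\<^sup>2" using n(3) by (simp add: power2_eq_square)
    finally show False by simp
  qed
  show ?thesis
    by (rule exI[of _ w], rule exI[of _ l]) (intro conjI allI lin inj AS ADK DF)
qed

end
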